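(* Let $\mathcal S=\{i_1,\dots,i_M\}$, $i_1<\dots<i_M$, let $\underline b=(b_2,\dots,b_{M-1})$ satisfy $-\frac{1}{i_{j+1}-i_j}<b_j<\frac{1}{i_j-i_{j-1}}$ for $j=2,\dots,M-1$, and let $\underline k,\underline\lambda\in\mathbb R_+^{M-2}$. Let $Y$ be a continuous time Markov process on $\mathcal S\cup\{D\}$ with transition intensity matrix $\Theta=\Theta(\underline k,\underline\lambda)$, in the sense that (writing $i_{M+1}=D$) $\lim_{h\to0}\frac1h\mathbb P(Y_h=i_n\mid Y_0=i_j)=\Theta_{jn}$ for $j\ne n$ in $\{1,\dots,M+1\}$ and $\lim_{h\to0}\frac1h(\mathbb P(Y_h=i_j\mid Y_0=i_j)-1)=\Theta_{jj}$ for $j\in\{1,\dots,M+1\}$. Let $a:\mathcal S\to\mathbb R_+$ be given by $a(i_j)=\lambda_j(i_{j+1}-i_j)(i_j-i_{j-1})$ for $j=2,\dots,M-1$ and $a(i_1)=a(i_M)=0$. Then $Y$ has infinitesimal generator $$a\Big(\frac12\Delta+b\nabla-k\Big).$$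
   Context: Conventions: $\mathbb R_+=[0,\infty)$, $M\ge3$. $D$ is an absorbing cemetery state (index $M+1$); functions $f$ on $\mathcal S$ are extended by $f(D)=0$, and $b(i_j)=b_j$, $k(i_j)=k_j$ for $2\le j\le M-1$. Set $\widetilde k_j=(i_{j+1}-i_j)(i_j-i_{j-1})k_j$ for $2\le j\le M-1$; for $2\le j\le M-1$, $q_{j,j+1}=\frac{i_j-i_{j-1}}{i_{j+1}-i_{j-1}}(1+(i_{j+1}-i_j)b_j)$, $q_{j,j-1}=\frac{i_{j+1}-i_j}{i_{j+1}-i_{j-1}}(1-(i_j-i_{j-1})b_j)$. $\Theta$ is the $(M+1)\times(M+1)$ matrix whose rows $1$, $M$, $M+1$ are zero and, for $2\le j\le M-1$, $\Theta_{j,j+1}=\lambda_jq_{j,j+1}$, $\Theta_{j,j-1}=\lambda_jq_{j,j-1}$ (neighbours in $\{1,\dots,M\}$), $\Theta_{jj}=-\lambda_j(1+\widetilde k_j)$, $\Theta_{j,M+1}=\lambda_j\widetilde k_j$, all other entries $0$. Discrete operators on $f:\mathcal S\to\mathbb R$: $\Delta f(i_1)=\Delta f(i_M)=\nabla f(i_1)=\nabla f(i_M)=0$ and, for $2\le j\le M-1$, $\Delta f(i_j)=\frac{2}{(i_{j+1}-i_j)(i_j-i_{j-1})}\Big(\frac{i_j-i_{j-1}}{i_{j+1}-i_{j-1}}f(i_{j+1})-f(i_j)+\frac{i_{j+1}-i_j}{i_{j+1}-i_{j-1}}f(i_{j-1})\Big)$, $\nabla f(i_j)=\frac{f(i_{j+1})-f(i_{j-1})}{i_{j+1}-i_{j-1}}$.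 The statement that $Y$ has generator $\mathcal L$ means that $F(t,i_j)=\mathbb E[f(Y_t)\mid Y_0=i_j]$ satisfies $\frac{\partial}{\partial t}F(t,i_j)=\mathcal LF(t,i_j)$ for $j=1,\dots,M$ and every $f:\mathcal S\to\mathbb R$. *)

theory Defs
  imports "HOL-Probability.Probability"
begin

text \<open>
  A time-homogeneous Markov process on a countable state space \<open>E\<close> is given by the family
  \<open>P x\<close> of its laws conditionally on \<open>Y\<^sub>0 = x\<close>, on one measurable space. No path regularity is
  assumed.
\<close>

definition markov_process :: "'s set \<Rightarrow> ('s \<Rightarrow> 'w measure) \<Rightarrow> (real \<Rightarrow> 'w \<Rightarrow> 's) \<Rightarrow> bool" where
  "markov_process E P Y \<longleftrightarrow>
     (\<forall>x\<in>E. prob_space (P x)) \<and>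
     (\<forall>x\<in>E. \<forall>y\<in>E. sets (P x) = sets (P y)) \<and>
     (\<forall>x\<in>E. \<forall>t\<ge>0. Y t \<in> measurable (P x) (count_space E)) \<and>
     (\<forall>x\<in>E. AE \<omega> in P x. Y 0 \<omega> = x) \<and>
     (\<forall>x\<in>E. \<forall>n. \<forall>\<tau> :: nat \<Rightarrow> real. \<forall>y :: nat \<Rightarrow> 's. \<forall>s\<ge>0. \<forall>z\<in>E.
        0 \<le> \<tau> 0 \<longrightarrow> strict_mono_on {..n} \<tau> \<longrightarrow> (\<forall>m\<le>n. y m \<in> E) \<longrightarrow>
        \<P>(\<omega> in P x. \<forall>m\<le>n. Y (\<tau> m) \<omega> = y m) > 0 \<longrightarrow>
        \<P>(\<omega> in P x. Y (\<tau> n + s) \<omega> = z \<bar> \<forall>m\<le>n. Y (\<tau> m) \<omega> = y m) =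
        \<P>(\<omega> in P (y n). Y s \<omega> = z))"

definition has_intensities ::
  "nat set \<Rightarrow> (nat \<Rightarrow> 's) \<Rightarrow> ('s \<Rightarrow> 'w measure) \<Rightarrow> (real \<Rightarrow> 'w \<Rightarrow> 's) \<Rightarrow> (nat \<Rightarrow> nat \<Rightarrow> real) \<Rightarrow> bool" where
  "has_intensities J e P Y Q \<longleftrightarrow>
     (\<forall>j\<in>J. \<forall>n\<in>J. j \<noteq> n \<longrightarrow>
        ((\<lambda>h. 1 / h * \<P>(\<omega> in P (e j). Y h \<omega> = e n)) \<longlongrightarrow> Q j n) (at_right 0)) \<and>
     (\<forall>j\<in>J. ((\<lambda>h. 1 / h * (\<P>(\<omega> in P (e j). Y h \<omega> = e j) - 1)) \<longlongrightarrow> Q j j) (at_right 0))"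

text \<open>
  The cemetery \<open>D\<close> is \<^term>\<open>None\<close>; a function \<open>f\<close> on the live states is extended by \<open>f(D) = 0\<close>.
\<close>

definition expect_from ::
  "('s option \<Rightarrow> 'w measure) \<Rightarrow> (real \<Rightarrow> 'w \<Rightarrow> 's option) \<Rightarrow> ('s \<Rightarrow> real) \<Rightarrow> real \<Rightarrow> 's \<Rightarrow> real" where
  "expect_from P Y f t x = (LINT \<omega>|P (Some x). case_option 0 f (Y t \<omega>))"

definition has_generator ::
  "'s set \<Rightarrow> ('s option \<Rightarrow> 'w measure) \<Rightarrow> (real \<Rightarrow> 'w \<Rightarrow> 's option)
     \<Rightarrow> (('s \<Rightarrow> real) \<Rightarrow> 's \<Rightarrow> real) \<Rightarrow> bool" where
  "has_generator S P Y L \<longleftrightarrow>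
     (\<forall>f. \<forall>x\<in>S. \<forall>t\<ge>0.
        ((\<lambda>u. expect_from P Y f u x) has_real_derivative L (expect_from P Y f t) x)
          (at t within {0..}))"

definition grid :: "nat \<Rightarrow> (nat \<Rightarrow> real) \<Rightarrow> real set" where
  "grid M i = i ` {1..M}"

definition state :: "nat \<Rightarrow> (nat \<Rightarrow> real) \<Rightarrow> nat \<Rightarrow> real option" where
  "state M i n = (if n = M + 1 then None else Some (i n))"

definition index :: "nat \<Rightarrow> (nat \<Rightarrow> real) \<Rightarrow> real \<Rightarrow> nat" where
  "index M i x = the_inv_into {1..M} i x"

definition laplacian :: "nat \<Rightarrow> (nat \<Rightarrow> real) \<Rightarrow> (real \<Rightarrow> real) \<Rightarrow> real \<Rightarrow> real" where
  "laplacian M i f x =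
     (let j = index M i x in
      if j \<in> {2..M-1} then
        2 / ((i (j+1) - i j) * (i j - i (j-1))) *
        ((i j - i (j-1)) / (i (j+1) - i (j-1)) * f (i (j+1)) - f (i j)
          + (i (j+1) - i j) / (i (j+1) - i (j-1)) * f (i (j-1)))
      else 0)"

definition gradient :: "nat \<Rightarrow> (nat \<Rightarrow> real) \<Rightarrow> (real \<Rightarrow> real) \<Rightarrow> real \<Rightarrow> real" where
  "gradient M i f x =
     (let j = index M i x in
      if j \<in> {2..M-1} then (f (i (j+1)) - f (i (j-1))) / (i (j+1) - i (j-1)) else 0)"

definition ktilde :: "(nat \<Rightarrow> real) \<Rightarrow> (nat \<Rightarrow> real) \<Rightarrow> nat \<Rightarrow> real" where
  "ktilde i k j = (i (j+1) - i j) * (i j - i (j-1)) * k j"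

definition q_up :: "(nat \<Rightarrow> real) \<Rightarrow> (nat \<Rightarrow> real) \<Rightarrow> nat \<Rightarrow> real" where
  "q_up i b j = (i j - i (j-1)) / (i (j+1) - i (j-1)) * (1 + (i (j+1) - i j) * b j)"

definition q_down :: "(nat \<Rightarrow> real) \<Rightarrow> (nat \<Rightarrow> real) \<Rightarrow> nat \<Rightarrow> real" where
  "q_down i b j = (i (j+1) - i j) / (i (j+1) - i (j-1)) * (1 - (i j - i (j-1)) * b j)"

text \<open>Rows and columns are indexed by \<open>{1..M+1}\<close>, with \<open>M+1\<close> the index of the cemetery.\<close>

definition Theta ::
  "nat \<Rightarrow> (nat \<Rightarrow> real) \<Rightarrow> (nat \<Rightarrow> real) \<Rightarrow> (nat \<Rightarrow> real) \<Rightarrow> (nat \<Rightarrow> real) \<Rightarrow> nat \<Rightarrow> nat \<Rightarrow> real" where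
  "Theta M i b k lam j n =
     (if j \<in> {2..M-1} then
        if n = j + 1 then lam j * q_up i b j
        else if n = j - 1 then lam j * q_down i b j
        else if n = j then - lam j * (1 + ktilde i k j)
        else if n = M + 1 then lam j * ktilde i k j
        else 0
      else 0)"

end

theory Submission imports Defs begin

text \<open>
  On the finite set \<open>\<S> \<union> {D}\<close> the Markov property gives
  \<open>F(t+h, \<cdot>) - F(t, \<cdot>) = (p\<^sub>h - I) F(t, \<cdot>)\<close>, and the intensities are the limits of
  \<open>(p\<^sub>h - I)/h\<close>, so \<open>F\<close> satisfies the backward equation \<open>\<partial>\<^sub>t F = \<Theta> F\<close> on \<open>\<S> \<union> {D}\<close>; for the
  derivative from the left one also uses that \<open>F\<close> is bounded, hence left-continuous.
  The row of \<open>\<Theta>\<close> at \<open>D\<close> vanishes, so \<open>F(\<cdot>, D)\<close> is constantly \<open>f(D) = 0\<close>, and \<open>\<Theta> F\<close> on \<open>\<S>\<close>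
  is \<open>a (\<Delta>/2 + b \<nabla> - k) F\<close> by direct computation.
\<close>

section \<open>Differentiating a finite family driven by short-time kernels\<close>

text \<open>Here the probability is stripped away. The kernel of the added time \<open>h\<close>
  acts on the index \<open>j\<close>, so every increment is \<open>h\<close> times a finite sum of
  difference quotients of \<open>p\<close> at time 0. Limits can then be taken term by term;
  continuity of \<open>F\<close> in time is derived rather than assumed.\<close>

lemma backward_equation:
  fixes p :: "real \<Rightarrow> 'i \<Rightarrow> 'i \<Rightarrow> real" and F :: "real \<Rightarrow> 'i \<Rightarrow> real"
  assumes fin: "finite J"
    and step: "\<And>t h j. 0 \<le> t \<Longrightarrow> 0 \<le> h \<Longrightarrow> j \<in> J \<Longrightarrow> F (t + h) j = (\<Sum>n\<in>J. p h j n * F t n)"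
    and bounded: "\<And>t j. 0 \<le> t \<Longrightarrow> j \<in> J \<Longrightarrow> \<bar>F t j\<bar> \<le> C"
    and lim: "\<And>j n. j \<in> J \<Longrightarrow> n \<in> J \<Longrightarrow>
      ((\<lambda>h. (p h j n - of_bool (j = n)) / h) \<longlongrightarrow> Q j n) (at_right 0)"
    and "0 \<le> t" and "j \<in> J"
  shows "((\<lambda>u. F u j) has_real_derivative (\<Sum>n\<in>J. Q j n * F t n)) (at t within {0..})"
proof -
  define d where "d h j n = (p h j n - of_bool (j = n)) / h" for h j n
  have lim_d: "((\<lambda>h. d h l n) \<longlongrightarrow> Q l n) (at_right 0)" if "l \<in> J" "n \<in> J" for l n
    using lim[OF that] by (simp add: d_def)
  have incr: "F (s + h) l - F s l = h * (\<Sum>n\<in>J. d h l n * F s n)"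
    if "0 \<le> s" "0 < h" "l \<in> J" for s h l
  proof -
    have "h * (\<Sum>n\<in>J. d h l n * F s n) = (\<Sum>n\<in>J. p h l n * F s n - (if l = n then F s n else 0))"
      unfolding sum_distrib_left using \<open>0 < h\<close>
      by (intro sum.cong) (auto simp: d_def field_simps)
    also have "\<dots> = F (s + h) l - F s l"
      using that fin by (simp add: sum_subtractf step)
    finally show ?thesis by simp
  qed
  have right: "((\<lambda>u. (F u j - F t j) / (u - t)) \<longlongrightarrow> (\<Sum>n\<in>J. Q j n * F t n)) (at_right t)"
  proof (subst filterlim_at_right_to_0, rule Lim_transform_eventually)
    show "((\<lambda>h. \<Sum>n\<in>J. d h j n * F t n) \<longlongrightarrow> (\<Sum>n\<in>J. Q j n * F t n)) (at_right 0)"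
      using \<open>j \<in> J\<close> by (intro tendsto_intros lim_d)
    show "\<forall>\<^sub>F h in at_right 0. (\<Sum>n\<in>J. d h j n * F t n) = (F (h + t) j - F t j) / (h + t - t)"
      using eventually_at_right_less
      by eventually_elim (use incr[OF \<open>0 \<le> t\<close> _ \<open>j \<in> J\<close>] in \<open>simp add: add.commute\<close>)
  qed
  have left: "((\<lambda>u. (F u j - F t j) / (u - t)) \<longlongrightarrow> (\<Sum>n\<in>J. Q j n * F t n)) (at_left t)"
    if "0 < t"
  proof -
    \<comment> \<open>The bound \<open>h < t\<close> keeps \<open>t - h\<close> positive, where
      \<open>incr\<close> and \<open>bounded\<close> apply.\<close>
    have small: "\<forall>\<^sub>F h in at_right 0. 0 < h \<and> h < t"
      using that eventually_at_right_real by fastforce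
    \<comment> \<open>The increment from \<open>t - h\<close> to \<open>t\<close> involves
      \<open>F (t - h)\<close> instead of \<open>F t\<close>, so the limit of
      \<open>F (t - h)\<close> must be known first.\<close>
    have cont: "((\<lambda>h. F (t - h) n) \<longlongrightarrow> F t n) (at_right 0)" if "n \<in> J" for n
    proof -
      have "((\<lambda>h. F (t - h) n - F t n) \<longlongrightarrow> 0) (at_right 0)"
      proof (rule Lim_null_comparison)
        \<comment> \<open>The quotients \<open>d h n m\<close> converge, so the sum has a finite
          limit and the factor \<open>h\<close> sends the product to 0.\<close>
        have "((\<lambda>h. h * (\<Sum>m\<in>J. \<bar>d h n m\<bar> * C)) \<longlongrightarrow> 0 * (\<Sum>m\<in>J. \<bar>Q n m\<bar> * C)) (at_right 0)"
          using that by (intro tendsto_intros lim_d)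
        then show "((\<lambda>h. h * (\<Sum>m\<in>J. \<bar>d h n m\<bar> * C)) \<longlongrightarrow> 0) (at_right 0)" by simp
        show "\<forall>\<^sub>F h in at_right 0. norm (F (t - h) n - F t n) \<le> h * (\<Sum>m\<in>J. \<bar>d h n m\<bar> * C)"
          using small
        proof eventually_elim
          case (elim h)
          have "norm (F (t - h) n - F t n) = \<bar>h * (\<Sum>m\<in>J. d h n m * F (t - h) m)\<bar>"
            using incr[of "t - h" h n] elim that by (simp add: abs_minus_commute)
          also have "\<dots> = h * \<bar>\<Sum>m\<in>J. d h n m * F (t - h) m\<bar>"
            using elim by (simp add: abs_mult)
          also have "\<dots> \<le> h * (\<Sum>m\<in>J. \<bar>d h n m\<bar> * C)"
            using elim by (intro mult_left_mono order_trans[OF sum_abs] sum_mono)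
              (auto simp: abs_mult intro!: mult_left_mono bounded)
          finally show ?case .
        qed
      qed
      then show ?thesis by (simp add: LIM_zero_iff)
    qed
    show ?thesis
    \<comment> \<open>Reflection followed by a shift turns the left limit at \<open>t\<close> into a
      right limit at 0; the term \<open>- (h + - t)\<close> below is \<open>t - h\<close>.\<close>
    proof (subst filterlim_at_left_to_right, subst filterlim_at_right_to_0,
        rule Lim_transform_eventually)
      show "((\<lambda>h. \<Sum>n\<in>J. d h j n * F (t - h) n) \<longlongrightarrow> (\<Sum>n\<in>J. Q j n * F t n)) (at_right 0)"
        using \<open>j \<in> J\<close> by (intro tendsto_intros lim_d cont)
      show "\<forall>\<^sub>F h in at_right 0. (\<Sum>n\<in>J. d h j n * F (t - h) n)
          = (F (- (h + - t)) j - F t j) / (- (h + - t) - t)"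
        using small
      proof eventually_elim
        case (elim h)
        then show ?case
          using incr[of "t - h" h j] \<open>j \<in> J\<close> by (simp add: field_simps)
      qed
    qed
  qed
  \<comment> \<open>The two one-sided limits are glued at \<open>t\<close>. For \<open>t = 0\<close>
    the left piece is a single point, whose punctured filter is trivial, so only the right limit
    counts.\<close>
  have "((\<lambda>u. (F u j - F t j) / (u - t)) \<longlongrightarrow> (\<Sum>n\<in>J. Q j n * F t n)) (at t within {0..t} \<union> {t..})"
  proof (subst Lim_within_Un, intro conjI)
    show "((\<lambda>u. (F u j - F t j) / (u - t)) \<longlongrightarrow> (\<Sum>n\<in>J. Q j n * F t n)) (at t within {0..t})"
    proof (cases "t = 0")
      case True
      then show ?thesis by (simp add: at_within_def)
    next
      case False
      then show ?thesis using left \<open>0 \<le> t\<close> by (simp add: at_within_Icc_at_left)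
    qed
    show "((\<lambda>u. (F u j - F t j) / (u - t)) \<longlongrightarrow> (\<Sum>n\<in>J. Q j n * F t n)) (at t within {t..})"
      using right by (simp add: at_within_Ici_at_right)
  qed
  moreover have "{0..t} \<union> {t..} = {0..}" using \<open>0 \<le> t\<close> by auto
  ultimately show ?thesis by (simp add: has_field_derivative_iff)
qed

section \<open>Markov processes on a finite state space\<close>

lemma (in prob_space) expectation_finite_range:
  fixes g :: "'s \<Rightarrow> real"
  assumes fin: "finite E" and X: "X \<in> measurable M (count_space E)"
  shows "expectation (\<lambda>\<omega>. g (X \<omega>)) = (\<Sum>z\<in>E. g z * \<P>(\<omega> in M. X \<omega> = z))"
proof -
  have sets: "{\<omega> \<in> space M. X \<omega> = z} \<in> events" if "z \<in> E" for z
    using measurable_sets[OF X, of "{z}"] that by (simp add: vimage_def Int_def conj_commute)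
  have "expectation (\<lambda>\<omega>. g (X \<omega>))
      = expectation (\<lambda>\<omega>. \<Sum>z\<in>E. g z * indicator {\<omega> \<in> space M. X \<omega> = z} \<omega>)"
  proof (rule Bochner_Integration.integral_cong[OF refl])
    fix \<omega> assume "\<omega> \<in> space M"
    then have "X \<omega> \<in> E" using measurable_space[OF X] by simp
    have "(\<Sum>z\<in>E. g z * indicator {\<omega> \<in> space M. X \<omega> = z} \<omega>)
        = (\<Sum>z\<in>E. if X \<omega> = z then g z else 0)"
      using \<open>\<omega> \<in> space M\<close> by (intro sum.cong) auto
    then show "g (X \<omega>) = (\<Sum>z\<in>E. g z * indicator {\<omega> \<in> space M. X \<omega> = z} \<omega>)"
      using \<open>X \<omega> \<in> E\<close> fin by simp
  qed
  also have "\<dots> = (\<Sum>z\<in>E. g z * \<P>(\<omega> in M. X \<omega> = z))"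
    using sets by (subst Bochner_Integration.integral_sum)
      (auto simp: emeasure_eq_measure Int_absorb2)
  finally show ?thesis .
qed

text \<open>Decompose according to the state at the intermediate time \<open>h\<close> and apply the
  Markov property there.\<close>

lemma markov_process_chapman_kolmogorov:
  assumes markov: "markov_process E P Y" and fin: "finite E"
    and "x \<in> E" "z \<in> E" "0 \<le> t" "0 \<le> h"
  shows "\<P>(\<omega> in P x. Y (h + t) \<omega> = z)
    = (\<Sum>y\<in>E. \<P>(\<omega> in P x. Y h \<omega> = y) * \<P>(\<omega> in P y. Y t \<omega> = z))"
proof -
  interpret prob_space "P x" using assms by (simp add: markov_process_def)
  have meas: "Y s \<in> measurable (P x) (count_space E)" if "0 \<le> s" for s
    using markov \<open>x \<in> E\<close> that by (simp add: markov_process_def)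
  have sets: "{\<omega> \<in> space (P x). Y s \<omega> = y} \<in> events" if "0 \<le> s" "y \<in> E" for s y
    using measurable_sets[OF meas, of s "{y}"] that
    by (simp add: vimage_def Int_def conj_commute)
  \<comment> \<open>The Markov property speaks only of conditioning events of positive probability;
    on a null event both sides vanish.\<close>
  have joint: "\<P>(\<omega> in P x. Y (h + t) \<omega> = z \<and> Y h \<omega> = y)
      = \<P>(\<omega> in P x. Y h \<omega> = y) * \<P>(\<omega> in P y. Y t \<omega> = z)" if "y \<in> E" for y
  proof (cases "\<P>(\<omega> in P x. Y h \<omega> = y) > 0")
    case True
    have "\<forall>n. \<forall>\<tau> :: nat \<Rightarrow> real. \<forall>y. \<forall>s\<ge>0. \<forall>z\<in>E.
        0 \<le> \<tau> 0 \<longrightarrow> strict_mono_on {..n} \<tau> \<longrightarrow> (\<forall>m\<le>n. y m \<in> E) \<longrightarrow>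
        \<P>(\<omega> in P x. \<forall>m\<le>n. Y (\<tau> m) \<omega> = y m) > 0 \<longrightarrow>
        \<P>(\<omega> in P x. Y (\<tau> n + s) \<omega> = z \<bar> \<forall>m\<le>n. Y (\<tau> m) \<omega> = y m) =
        \<P>(\<omega> in P (y n). Y s \<omega> = z)"
      using markov \<open>x \<in> E\<close> unfolding markov_process_def by blast
    \<comment> \<open>A single conditioning time suffices: with \<open>n = 0\<close> the constant
      sequence \<open>h\<close> is strictly increasing on a one-point index set.\<close>
    moreover have "strict_mono_on {..0::nat} (\<lambda>_. h)"
      by (rule strict_mono_onI) auto
    ultimately have "\<P>(\<omega> in P x. Y (h + t) \<omega> = z \<bar> \<forall>m\<le>0::nat. Y h \<omega> = y)
        = \<P>(\<omega> in P y. Y t \<omega> = z)"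
      using True that assms(4-6)
      by (auto dest!: spec[of _ "0::nat"] spec[of _ "\<lambda>_. h"] spec[of _ "\<lambda>_. y"])
    then show ?thesis using True by (simp add: cond_prob_def field_simps)
  next
    case False
    then have "\<P>(\<omega> in P x. Y h \<omega> = y) = 0"
      using zero_less_measure_iff by blast
    moreover have "\<P>(\<omega> in P x. Y (h + t) \<omega> = z \<and> Y h \<omega> = y) \<le> \<P>(\<omega> in P x. Y h \<omega> = y)"
      using sets that \<open>0 \<le> h\<close> by (intro finite_measure_mono) auto
    ultimately show ?thesis by (simp add: measure_le_0_iff)
  qed
  have "\<P>(\<omega> in P x. Y (h + t) \<omega> = z)
      = measure (P x) (\<Union>y\<in>E. {\<omega> \<in> space (P x). Y (h + t) \<omega> = z \<and> Y h \<omega> = y})"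
    using measurable_space[OF meas[OF \<open>0 \<le> h\<close>]] by (intro arg_cong[where f = prob]) auto
  also have "\<dots> = (\<Sum>y\<in>E. \<P>(\<omega> in P x. Y (h + t) \<omega> = z \<and> Y h \<omega> = y))"
  proof (rule finite_measure_finite_Union[OF fin])
    have "{\<omega> \<in> space (P x). Y (h + t) \<omega> = z \<and> Y h \<omega> = y} \<in> events" if "y \<in> E" for y
      using sets.Int[OF sets[of "h + t" z] sets[of h y]] assms that
      by (simp add: Int_def conj_ac)
    then show "(\<lambda>y. {\<omega> \<in> space (P x). Y (h + t) \<omega> = z \<and> Y h \<omega> = y}) ` E \<subseteq> events" by auto
    show "disjoint_family_on (\<lambda>y. {\<omega> \<in> space (P x). Y (h + t) \<omega> = z \<and> Y h \<omega> = y}) E"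
      by (auto simp: disjoint_family_on_def)
  qed
  also have "\<dots> = (\<Sum>y\<in>E. \<P>(\<omega> in P x. Y h \<omega> = y) * \<P>(\<omega> in P y. Y t \<omega> = z))"
    by (intro sum.cong joint refl)
  finally show ?thesis .
qed

text \<open>Chapman-Kolmogorov with the finite sums exchanged. The transition over \<open>h\<close>
  comes first and the expectation restarts from the state reached, which is the shape of
  \<open>step\<close> in \<open>backward_equation\<close>.\<close>

lemma markov_process_expectation_step:
  fixes g :: "'s \<Rightarrow> real"
  assumes markov: "markov_process E P Y" and fin: "finite E"
    and "x \<in> E" "0 \<le> t" "0 \<le> h"
  shows "(LINT \<omega>|P x. g (Y (h + t) \<omega>))
    = (\<Sum>y\<in>E. \<P>(\<omega> in P x. Y h \<omega> = y) * (LINT \<omega>|P y. g (Y t \<omega>)))"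
proof -
  have ex: "(LINT \<omega>|P y. g (Y s \<omega>)) = (\<Sum>z\<in>E. g z * \<P>(\<omega> in P y. Y s \<omega> = z))"
    if "y \<in> E" "0 \<le> s" for y s
    using markov that fin unfolding markov_process_def
    by (intro prob_space.expectation_finite_range) auto
  have "(LINT \<omega>|P x. g (Y (h + t) \<omega>))
      = (\<Sum>z\<in>E. \<Sum>y\<in>E. g z * (\<P>(\<omega> in P x. Y h \<omega> = y) * \<P>(\<omega> in P y. Y t \<omega> = z)))"
    using assms by (simp add: ex markov_process_chapman_kolmogorov sum_distrib_left)
  also have "\<dots> = (\<Sum>y\<in>E. \<P>(\<omega> in P x. Y h \<omega> = y) * (LINT \<omega>|P y. g (Y t \<omega>)))"
    using assms by (subst sum.swap) (simp add: ex sum_distrib_left mult_ac)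
  finally show ?thesis .
qed

text \<open>Kolmogorov's backward equation, obtained by taking the transition probabilities as
  \<open>p\<close> and the expectations from each starting state as \<open>F\<close>.\<close>

theorem markov_process_backward_equation:
  fixes g :: "'s \<Rightarrow> real"
  assumes markov: "markov_process E P Y" and e: "bij_betw e J E" and fin: "finite J"
    and intens: "has_intensities J e P Y Q"
    and "0 \<le> t" "j \<in> J"
  shows "((\<lambda>u. LINT \<omega>|P (e j). g (Y u \<omega>)) has_real_derivative
      (\<Sum>n\<in>J. Q j n * (LINT \<omega>|P (e n). g (Y t \<omega>)))) (at t within {0..})"
proof -
  have finE: "finite E" using e fin bij_betw_finite by blast
  have eE: "e n \<in> E" if "n \<in> J" for n using e that bij_betwE by blast
  have ps: "prob_space (P x)" if "x \<in> E" for x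
    using markov that by (simp add: markov_process_def)
  have step: "(LINT \<omega>|P (e l). g (Y (s + h) \<omega>))
      = (\<Sum>n\<in>J. \<P>(\<omega> in P (e l). Y h \<omega> = e n) * (LINT \<omega>|P (e n). g (Y s \<omega>)))"
    if "0 \<le> s" "0 \<le> h" "l \<in> J" for s h l
    using markov_process_expectation_step[OF markov finE eE[OF that(3)] that(1,2), of g]
    by (subst sum.reindex_bij_betw[OF e]) (simp add: add.commute)
  \<comment> \<open>Each probability is at most 1, so this bound is uniform in the time and the
    starting state.\<close>
  have bound: "\<bar>LINT \<omega>|P (e l). g (Y s \<omega>)\<bar> \<le> (\<Sum>z\<in>E. \<bar>g z\<bar>)" if "0 \<le> s" "l \<in> J" for s l
  proof -
    interpret prob_space "P (e l)" using ps eE that by blast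
    have "(LINT \<omega>|P (e l). g (Y s \<omega>)) = (\<Sum>z\<in>E. g z * \<P>(\<omega> in P (e l). Y s \<omega> = z))"
      using markov eE that finE unfolding markov_process_def
      by (intro expectation_finite_range) auto
    also have "\<bar>\<dots>\<bar> \<le> (\<Sum>z\<in>E. \<bar>g z\<bar>)"
      by (intro order_trans[OF sum_abs] sum_mono)
        (auto simp: abs_mult intro!: mult_left_le)
    finally show ?thesis .
  qed
  have lim: "((\<lambda>h. (\<P>(\<omega> in P (e l). Y h \<omega> = e n) - of_bool (l = n)) / h) \<longlongrightarrow> Q l n) (at_right 0)"
    if "l \<in> J" "n \<in> J" for l n
    using intens that unfolding has_intensities_def by (cases "l = n") auto
  show ?thesis
    using backward_equation[where F = "\<lambda>s l. LINT \<omega>|P (e l). g (Y s \<omega>)"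
        and p = "\<lambda>h l n. \<P>(\<omega> in P (e l). Y h \<omega> = e n)", OF fin step bound lim] assms(5,6)
    by blast
qed

section \<open>The matrix \<open>Theta\<close> on the grid and its rows as difference
  operators\<close>

lemma bij_betw_state:
  assumes "inj_on i {1..M}"
  shows "bij_betw (state M i) {1..M+1} (insert None (Some ` grid M i))"
proof -
  have live: "state M i n = Some (i n)" if "n \<in> {1..M}" for n
    using that by (simp add: state_def)
  have dead: "state M i (M+1) = None" by (simp add: state_def)
  have "bij_betw (state M i) {1..M} (Some ` grid M i)"
  proof (rule bij_betw_imageI)
    show "inj_on (state M i) {1..M}"
      using assms by (metis (no_types, lifting) inj_on_def live option.inject)
    show "state M i ` {1..M} = Some ` grid M i"
      unfolding grid_def image_image by (rule image_cong[OF refl live])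
  qed
  then have "bij_betw (state M i) ({1..M} \<union> {M+1}) (Some ` grid M i \<union> {None})"
    using dead by (intro bij_betw_combine) (auto simp: bij_betw_def)
  moreover have "{1..M} \<union> {M+1} = {1..M+1}" by auto
  ultimately show ?thesis by simp
qed

lemma Theta_row_sum:
  fixes F :: "nat \<Rightarrow> real"
  assumes "j \<in> {2..M-1}" and "F (M+1) = 0"
  shows "(\<Sum>n\<in>{1..M+1}. Theta M i b k lam j n * F n)
    = lam j * (q_up i b j * F (j+1) + q_down i b j * F (j-1) - (1 + ktilde i k j) * F j)"
proof -
  \<comment> \<open>The cemetery column is removed by \<open>F (M+1) = 0\<close>, so killing remains
    visible only in the diagonal entry.\<close>
  have "(\<Sum>n\<in>{1..M+1}. Theta M i b k lam j n * F n)
      = (\<Sum>n\<in>{j-1, j, j+1}. Theta M i b k lam j n * F n)"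
    using assms by (intro sum.mono_neutral_right) (auto simp: Theta_def)
  also have "\<dots> = Theta M i b k lam j (j-1) * F (j-1) + Theta M i b k lam j j * F j
      + Theta M i b k lam j (j+1) * F (j+1)"
    using assms(1) by (cases j) auto
  also have "Theta M i b k lam j (j-1) = lam j * q_down i b j"
    using assms(1) by (auto simp: Theta_def)
  also have "Theta M i b k lam j j = - lam j * (1 + ktilde i k j)"
    using assms(1) by (auto simp: Theta_def)
  also have "Theta M i b k lam j (j+1) = lam j * q_up i b j"
    using assms(1) by (simp add: Theta_def)
  finally show ?thesis by (simp add: algebra_simps)
qed

text \<open>Here \<open>u\<close> and \<open>v\<close> are the gaps to the right and left
  neighbours, and \<open>f0\<close>, \<open>f1\<close>, \<open>f2\<close> the values at the left,
  middle and right points. The parts without \<open>bb\<close> and \<open>kk\<close> give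
  \<open>u * v\<close> times half the Laplacian; both drift corrections carry
  \<open>u * v / (u + v)\<close> and combine to the gradient.\<close>

lemma generator_row_identity:
  fixes u v bb kk l f0 f1 f2 :: real
  assumes "0 < u" "0 < v"
  shows "l * (v / (u + v) * (1 + u * bb) * f2 + u / (u + v) * (1 - v * bb) * f0
      - (1 + u * v * kk) * f1)
    = l * u * v * (1/2 * (2 / (u * v) * (v / (u + v) * f2 - f1 + u / (u + v) * f0))
      + bb * ((f2 - f0) / (u + v)) - kk * f1)"
proof -
  have "u + v \<noteq> 0" using assms by simp
  then show ?thesis using assms by (simp add: divide_simps) (simp add: algebra_simps)
qed

section \<open>From the backward equation to the generator: cemetery, interior points,
  endpoints\<close>

theorem lemma2p5:
  fixes M :: nat
    and i :: "nat \<Rightarrow> real"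
    and bv kv lam :: "nat \<Rightarrow> real"
    and a b k :: "real \<Rightarrow> real"
    and P :: "real option \<Rightarrow> 'w measure"
    and Y :: "real \<Rightarrow> 'w \<Rightarrow> real option"
  assumes "M \<ge> 3"
    and "strict_mono_on {1..M} i"
    and "\<And>j. j \<in> {2..M-1} \<Longrightarrow> - 1 / (i (j+1) - i j) < bv j \<and> bv j < 1 / (i j - i (j-1))"
    and "\<And>j. j \<in> {2..M-1} \<Longrightarrow> kv j \<ge> 0"
    and "\<And>j. j \<in> {2..M-1} \<Longrightarrow> lam j \<ge> 0"
    and "markov_process (insert None (Some ` grid M i)) P Y"
    and "has_intensities {1..M+1} (state M i) P Y (Theta M i bv kv lam)"
    and "\<And>j. j \<in> {2..M-1} \<Longrightarrow> a (i j) = lam j * (i (j+1) - i j) * (i j - i (j-1))"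
    and "a (i 1) = 0" and "a (i M) = 0"
    and "\<And>j. j \<in> {2..M-1} \<Longrightarrow> b (i j) = bv j"
    and "\<And>j. j \<in> {2..M-1} \<Longrightarrow> k (i j) = kv j"
  shows "has_generator (grid M i) P Y
           (\<lambda>f x. a x * (1/2 * laplacian M i f x + b x * gradient M i f x - k x * f x))"
  unfolding has_generator_def
proof (intro allI ballI impI)
  fix f :: "real \<Rightarrow> real" and x t :: real
  assume "x \<in> grid M i" "0 \<le> t"
  then obtain j where j: "j \<in> {1..M}" "x = i j" by (auto simp: grid_def)
  have inj: "inj_on i {1..M}" using assms(2) by (rule strict_mono_on_imp_inj_on)
  then have idx: "index M i (i j) = j" unfolding index_def using j by (intro the_inv_into_f_f)
  \<comment> \<open>The family includes the start in the cemetery, because the backward equation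
    couples all \<open>M + 1\<close> states.\<close>
  define F where "F s n = (LINT \<omega>|P (state M i n). case_option 0 f (Y s \<omega>))" for s n
  have F_live: "F s n = expect_from P Y f s (i n)" if "n \<noteq> M + 1" for s n
    using that by (simp add: F_def state_def expect_from_def)
  have deriv: "((\<lambda>u. F u n) has_real_derivative (\<Sum>m\<in>{1..M+1}. Theta M i bv kv lam n m * F s m))
      (at s within {0..})" if "n \<in> {1..M+1}" "0 \<le> s" for n s
    unfolding F_def using that
    by (intro markov_process_backward_equation[OF assms(6) bij_betw_state[OF inj] _ assms(7)]) auto
  \<comment> \<open>That \<open>D\<close> is absorbing is not a separate assumption: it enters
    through the zero row of \<open>Theta\<close>, which makes the derivative vanish on all of
    \<open>{0..}\<close>. The constant is read off at time 0, where \<open>Y 0 = None\<close> holds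
    almost surely.\<close>
  have F_dead: "F t (M+1) = 0"
  proof -
    have "((\<lambda>u. F u (M+1)) has_real_derivative 0) (at s within {0..})" if "0 \<le> s" for s
    proof -
      have "Theta M i bv kv lam (M+1) m = 0" for m by (auto simp: Theta_def)
      then show ?thesis using deriv[of "M+1" s] that by simp
    qed
    then have "\<exists>c. \<forall>s\<in>{0..}. F s (M+1) = c"
      by (intro has_field_derivative_zero_constant) auto
    then have "F t (M+1) = F 0 (M+1)" using \<open>0 \<le> t\<close> by auto
    also have "\<dots> = (LINT \<omega>|P None. 0)"
    proof -
      have Y0: "AE \<omega> in P None. Y 0 \<omega> = None"
        and meas: "Y 0 \<in> measurable (P None) (count_space (insert None (Some ` grid M i)))"
        using assms(6) by (auto simp: markov_process_def)
      have "(\<lambda>\<omega>. case_option 0 f (Y 0 \<omega>)) \<in> borel_measurable (P None)"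
        by (rule measurable_compose[OF meas]) simp
      then have "(LINT \<omega>|P None. case_option 0 f (Y 0 \<omega>)) = (LINT \<omega>|P None. 0)"
        by (rule integral_cong_AE) (use Y0 in auto)
      then show ?thesis by (simp add: F_def state_def)
    qed
    finally show ?thesis by simp
  qed
  have "(\<Sum>n\<in>{1..M+1}. Theta M i bv kv lam j n * F t n)
      = a x * (1/2 * laplacian M i (expect_from P Y f t) x
        + b x * gradient M i (expect_from P Y f t) x - k x * expect_from P Y f t x)"
  proof (cases "j \<in> {2..M-1}")
    case True
    define u where "u = i (j+1) - i j"
    define v where "v = i j - i (j-1)"
    have uv: "0 < u" "0 < v"
      unfolding u_def v_def diff_gt_0_iff_gt
      using True by (intro strict_mono_onD[OF assms(2)]; simp; linarith)+
    have width: "i (j+1) - i (j-1) = u + v" by (simp add: u_def v_def)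
    \<comment> \<open>An interior \<open>j\<close> has \<open>j + 1 \<le> M\<close>, so neither it
      nor a neighbour is the cemetery index.\<close>
    have live: "F t n = expect_from P Y f t (i n)" if "n \<in> {j-1, j, j+1}" for n
      using that True by (intro F_live) auto
    have "(\<Sum>n\<in>{1..M+1}. Theta M i bv kv lam j n * F t n)
      = lam j * (q_up i bv j * F t (j+1) + q_down i bv j * F t (j-1)
        - (1 + ktilde i kv j) * F t j)"
      using Theta_row_sum[OF True, of "F t"] F_dead by simp
    also have "\<dots> = a x * (1/2 * laplacian M i (expect_from P Y f t) x
        + b x * gradient M i (expect_from P Y f t) x - k x * expect_from P Y f t x)"
      unfolding j(2) laplacian_def gradient_def Let_def idx if_P[OF True]
        assms(8)[OF True] assms(11)[OF True] assms(12)[OF True] q_up_def q_down_def ktilde_def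
        width u_def[symmetric] v_def[symmetric]
      using generator_row_identity[OF uv] by (simp add: live)
    finally show ?thesis .
  next
    case False
    \<comment> \<open>At the endpoints \<open>b\<close> and \<open>k\<close> are arbitrary, so the
      right side is cancelled by \<open>a x = 0\<close>, matching the zero row of
      \<open>Theta\<close>.\<close>
    then have "j = 1 \<or> j = M" using j assms(1) by auto
    then have "a x = 0" using j assms(9,10) by auto
    moreover have "Theta M i bv kv lam j n = 0" for n
      unfolding Theta_def using False by (rule if_not_P)
    ultimately show ?thesis by simp
  qed
  moreover have "(\<lambda>u. F u j) = (\<lambda>u. expect_from P Y f u x)"
    using j by (simp add: F_live)
  ultimately show "((\<lambda>u. expect_from P Y f u x) has_real_derivative
      a x * (1/2 * laplacian M i (expect_from P Y f t) x
        + b x * gradient M i (expect_from P Y f t) x - k x * expect_from P Y f t x))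
      (at t within {0..})"
    using deriv[of j t] j \<open>0 \<le> t\<close> by simp
qed

end
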